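(* The operators $\tilde u_i=u_i(1+d_{\mu,i})$, $i\ge1$, on $M$ satisfy: (i) $\tilde u_i\tilde u_k\tilde u_j=\tilde u_k\tilde u_i\tilde u_j$ for $i<j<k$; (ii) $\tilde u_j\tilde u_k\tilde u_i=\tilde u_j\tilde u_i\tilde u_k$ for $i<j<k$; (iii) $\tilde u_j(\tilde u_i\tilde u_j-\tilde u_j\tilde u_i)=(\tilde u_i\tilde u_j-\tilde u_j\tilde u_i)\tilde u_i$ for $i<j$.
   Context: Fix a partition $\mu$ and indeterminates $\alpha,\beta$. Let $M$ be the $\mathbb{Z}[\alpha,\beta]$-module of formal (possibly infinite) $\mathbb{Z}[\alpha,\beta]$-linear combinations of partitions $\lambda\supseteq\mu$. Column-adding operators: $u_i\cdot\lambda=\sum_{a\ge1}\alpha^{a-1}\lambda^{+a,i}$, summed over $a\ge1$ such that adding $a$ boxes to the bottom of the $i$-th column of $\lambda$ yields a partition $\lambda^{+a,i}$ (zero if none). Schur operators: $d_{\mu,i}\cdot\lambda=\beta\,\lambda^{-i}$ if removing the bottom box of the $i$-th column of $\lambda$ yields a partition $\lambda^{-i}\supseteq\mu$, and $0$ otherwise. Operators are extended linearly and composed right to left. *)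

theory Defs
  imports "HOL-Library.Function_Algebras" "HOL-Computational_Algebra.Polynomial"
begin

section \<open>Partitions and Young diagrams\<close>

text \<open>A partition is a weakly decreasing, eventually zero sequence of row lengths;
  rows are numbered from 0, columns from 1.\<close>

typedef partition = "{p :: nat \<Rightarrow> nat. antimono p \<and> finite {r. p r \<noteq> 0}}"
  morphisms row Abs_partition
  by (rule exI[of _ "\<lambda>_. 0"]) (auto simp: monotone_def)

definition diagram :: "partition \<Rightarrow> (nat \<times> nat) set" where
  "diagram p = {(r, c). 1 \<le> c \<and> c \<le> row p r}"

definition contains :: "partition \<Rightarrow> partition \<Rightarrow> bool" where
  "contains p q \<longleftrightarrow> diagram q \<subseteq> diagram p"

definition col_len :: "partition \<Rightarrow> nat \<Rightarrow> nat" where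
  "col_len p i = card {r. (r, i) \<in> diagram p}"

text \<open>\<open>add_boxes p a i q\<close> says that adding \<open>a\<close> boxes to the bottom of column \<open>i\<close> of \<open>p\<close> yields
  the partition \<open>q\<close>; \<open>remove_box p i q\<close> says that column \<open>i\<close> of \<open>p\<close> is nonempty and that removing
  its bottom box yields the partition \<open>q\<close>.  As rows are numbered from 0, the boxes of column \<open>i\<close>
  lie in the rows below \<open>col_len p i\<close>.\<close>

definition add_boxes :: "partition \<Rightarrow> nat \<Rightarrow> nat \<Rightarrow> partition \<Rightarrow> bool" where
  "add_boxes p a i q \<longleftrightarrow> diagram q = diagram p \<union> {col_len p i ..< col_len p i + a} \<times> {i}"

definition remove_box :: "partition \<Rightarrow> nat \<Rightarrow> partition \<Rightarrow> bool" where
  "remove_box p i q \<longleftrightarrow> 1 \<le> col_len p i \<and> diagram q = diagram p - {(col_len p i - 1, i)}"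


section \<open>The module of formal linear combinations\<close>

text \<open>\<open>coeff_ring\<close> is the polynomial ring \<open>\<int>[\<alpha>][\<beta>]\<close>.\<close>

type_synonym coeff_ring = "int poly poly"

definition \<alpha> :: coeff_ring where "\<alpha> = [:[:0, 1:]:]"
definition \<beta> :: coeff_ring where "\<beta> = [:0, 1:]"

text \<open>A possibly infinite formal linear combination is its coefficient function.\<close>

type_synonym formal = "partition \<Rightarrow> coeff_ring"

definition M :: "partition \<Rightarrow> formal set" where
  "M \<mu> = {f. \<forall>p. f p \<noteq> 0 \<longrightarrow> contains p \<mu>}"

text \<open>Linear extension, to possibly infinite combinations, of a map \<open>T\<close> given on the basis.
  It is meaningful when, for each \<open>q\<close>, only finitely many \<open>T p\<close> involve \<open>q\<close>; this is
  \<open>finite_fibre_u\<close> and \<open>finite_fibre_d\<close> below for the operators in question.\<close>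

definition lin_ext :: "(partition \<Rightarrow> formal) \<Rightarrow> formal \<Rightarrow> formal" where
  "lin_ext T f = (\<lambda>q. \<Sum>p | T p q \<noteq> 0. f p * T p q)"


section \<open>The operators\<close>

text \<open>For given \<open>p\<close>, \<open>i\<close>, \<open>q\<close> at most one \<open>a\<close> occurs in the sum (see \<open>add_boxes_unique\<close>), so this
  is the coefficient of \<open>q\<close> in the formal sum over all admissible \<open>a\<close>.\<close>

definition u_basis :: "nat \<Rightarrow> partition \<Rightarrow> formal" where
  "u_basis i p = (\<lambda>q. \<Sum>a | 1 \<le> a \<and> add_boxes p a i q. \<alpha> ^ (a - 1))"

definition d_basis :: "partition \<Rightarrow> nat \<Rightarrow> partition \<Rightarrow> formal" where
  "d_basis \<mu> i p = (\<lambda>q. if remove_box p i q \<and> contains q \<mu> then \<beta> else 0)"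

definition u :: "nat \<Rightarrow> formal \<Rightarrow> formal" where
  "u i = lin_ext (u_basis i)"

definition d :: "partition \<Rightarrow> nat \<Rightarrow> formal \<Rightarrow> formal" where
  "d \<mu> i = lin_ext (d_basis \<mu> i)"

text \<open>Sums and differences of operators are pointwise; the product of operators is composition.\<close>

definition u_tilde :: "partition \<Rightarrow> nat \<Rightarrow> formal \<Rightarrow> formal" where
  "u_tilde \<mu> i = u i \<circ> (id + d \<mu> i)"

text \<open>The parentheses are needed: \<open>-\<close> binds more tightly than \<open>\<circ>\<close>.\<close>

definition commutator :: "(formal \<Rightarrow> formal) \<Rightarrow> (formal \<Rightarrow> formal) \<Rightarrow> formal \<Rightarrow> formal" where
  "commutator S T = (S \<circ> T) - (T \<circ> S)"


section \<open>Well-definedness\<close>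

lemma finite_diagram: "finite (diagram p)"
proof -
  have *: "antimono (row p)" "finite {r. row p r \<noteq> 0}" using row[of p] by auto
  have "diagram p \<subseteq> {r. row p r \<noteq> 0} \<times> {..row p 0}"
  proof
    fix b assume "b \<in> diagram p"
    moreover have "row p (fst b) \<le> row p 0" using *(1) by (simp add: monotone_def)
    ultimately show "b \<in> {r. row p r \<noteq> 0} \<times> {..row p 0}"
      by (auto simp: diagram_def mem_Times_iff)
  qed
  then show ?thesis using *(2) finite_subset by blast
qed

lemma diagram_inject: "diagram p = diagram q \<longleftrightarrow> p = q"
proof
  assume eq: "diagram p = diagram q"
  have r: "row x r = card {c. (r, c) \<in> diagram x}" for x r
  proof -
    have "{c. (r, c) \<in> diagram x} = {1..row x r}" by (auto simp: diagram_def)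
    then show ?thesis by simp
  qed
  have "row p = row q" using eq r by (auto simp: fun_eq_iff)
  then show "p = q" by (simp add: row_inject)
qed simp

lemma column_eq: "{r. (r, i) \<in> diagram p} = {..<col_len p i}"
proof -
  define S where "S = {r. (r, i) \<in> diagram p}"
  have anti: "antimono (row p)" using row[of p] by auto
  have "S = fst ` (diagram p \<inter> UNIV \<times> {i})" by (force simp: S_def)
  then have fin: "finite S" using finite_diagram by simp
  have down: "r \<in> S" if "s \<in> S" "r \<le> s" for r s
    using that anti by (auto simp: S_def diagram_def monotone_def intro: order_trans)
  have "S = {..<card S}"
  proof (cases "S = {}")
    case False
    have "S = {..Max S}"
      using fin down[OF Max_in[OF fin False]] by auto
    then show ?thesis by (metis card_atMost lessThan_Suc_atMost)
  qed simp
  then show ?thesis by (simp add: S_def col_len_def)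
qed

lemma add_boxes_col_len:
  assumes "add_boxes p a i q"
  shows "col_len q i = col_len p i + a"
proof -
  have "{..<col_len q i} = {r. (r, i) \<in> diagram q}" by (simp only: column_eq)
  also have "\<dots> = {r. (r, i) \<in> diagram p} \<union> {col_len p i ..< col_len p i + a}"
    using assms by (simp only: add_boxes_def) blast
  also have "\<dots> = {..<col_len p i + a}"
    unfolding column_eq by (simp only: set_eq_iff Un_iff lessThan_iff atLeastLessThan_iff) linarith
  finally show ?thesis by (simp only: lessThan_eq_iff)
qed

lemma add_boxes_unique:
  assumes "add_boxes p a i q" "add_boxes p b i q"
  shows "a = b"
  using assms[THEN add_boxes_col_len] by simp

lemma u_basis_eq:
  assumes "1 \<le> a" "add_boxes p a i q"
  shows "u_basis i p q = \<alpha> ^ (a - 1)"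
proof -
  have "{b. 1 \<le> b \<and> add_boxes p b i q} = {a}"
    using assms add_boxes_unique by blast
  then show ?thesis by (simp add: u_basis_def)
qed

lemma u_basis_nonzeroD: "u_basis i p q \<noteq> 0 \<Longrightarrow> \<exists>a\<ge>1. add_boxes p a i q"
  unfolding u_basis_def by (erule sum.not_neutral_contains_not_neutral) blast

lemma d_basis_nonzeroD: "d_basis \<mu> i p q \<noteq> 0 \<Longrightarrow> remove_box p i q \<and> contains q \<mu>"
  by (auto simp: d_basis_def split: if_splits)

lemma finite_fibre_u: "finite {p. u_basis i p q \<noteq> 0}"
proof -
  have "diagram ` {p. u_basis i p q \<noteq> 0} \<subseteq> Pow (diagram q)"
    using u_basis_nonzeroD by (fastforce simp: add_boxes_def)
  then have "finite (diagram ` {p. u_basis i p q \<noteq> 0})"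
    using finite_diagram finite_subset by blast
  then show ?thesis by (rule finite_imageD) (auto simp: inj_on_def diagram_inject)
qed

lemma remove_box_imp_add_boxes: "remove_box p i q \<Longrightarrow> add_boxes q 1 i p"
proof -
  assume rem: "remove_box p i q"
  then have pos: "1 \<le> col_len p i" and q: "diagram q = diagram p - {(col_len p i - 1, i)}"
    by (auto simp: remove_box_def)
  have "col_len p i - 1 \<in> {r. (r, i) \<in> diagram p}" using pos by (simp add: column_eq)
  then have "diagram p = insert (col_len p i - 1, i) (diagram q)" using q by auto
  moreover have "col_len q i = col_len p i - 1"
  proof -
    have "{..<col_len q i} = {..<col_len p i} - {col_len p i - 1}"
      unfolding column_eq[symmetric] using q by auto
    also have "\<dots> = {..<col_len p i - 1}" using pos by auto
    finally show ?thesis by (simp add: lessThan_eq_iff)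
  qed
  ultimately show ?thesis by (auto simp: add_boxes_def)
qed

lemma finite_fibre_d: "finite {p. d_basis \<mu> i p q \<noteq> 0}"
proof -
  have "diagram ` {p. d_basis \<mu> i p q \<noteq> 0} \<subseteq> {diagram q \<union> {col_len q i ..< col_len q i + 1} \<times> {i}}"
    using d_basis_nonzeroD remove_box_imp_add_boxes add_boxes_def by blast
  then have "finite (diagram ` {p. d_basis \<mu> i p q \<noteq> 0})" by (rule finite_subset) simp
  then show ?thesis by (rule finite_imageD) (auto simp: inj_on_def diagram_inject)
qed

lemma lin_ext_nonzeroD: "lin_ext T f q \<noteq> 0 \<Longrightarrow> \<exists>p. f p \<noteq> 0 \<and> T p q \<noteq> 0"
  unfolding lin_ext_def by (erule sum.not_neutral_contains_not_neutral) auto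

lemma u_in_M: "f \<in> M \<mu> \<Longrightarrow> u i f \<in> M \<mu>"
  unfolding M_def u_def contains_def add_boxes_def
proof clarify
  fix q r c
  assume f: "\<forall>p. f p \<noteq> 0 \<longrightarrow> diagram \<mu> \<subseteq> diagram p"
    and q: "lin_ext (u_basis i) f q \<noteq> 0" and rc: "(r, c) \<in> diagram \<mu>"
  from q obtain p where "f p \<noteq> 0" "u_basis i p q \<noteq> 0" using lin_ext_nonzeroD by blast
  then show "(r, c) \<in> diagram q"
    using f rc u_basis_nonzeroD[of i p q] by (auto simp: add_boxes_def)
qed

lemma d_in_M: "d \<mu> i f \<in> M \<mu>"
  by (auto simp: M_def d_def dest!: lin_ext_nonzeroD d_basis_nonzeroD)

lemma u_tilde_in_M:
  assumes f: "f \<in> M \<mu>"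
  shows "u_tilde \<mu> i f \<in> M \<mu>"
proof -
  have "f p + d \<mu> i f p = 0" if "\<not> contains p \<mu>" for p
  proof -
    have "f p = 0" "d \<mu> i f p = 0" using that f d_in_M[of \<mu> i f] by (auto simp: M_def)
    then show ?thesis by simp
  qed
  then have "f + d \<mu> i f \<in> M \<mu>" by (auto simp: M_def)
  then show ?thesis by (simp add: u_tilde_def u_in_M)
qed

end

theory Submission
  imports Defs
begin

text \<open>
  In terms of column lengths, \<open>u_tilde \<mu> i\<close> replaces the length \<open>a\<close> of column \<open>i\<close> by some \<open>b \<ge> a\<close>,
  with a weight depending only on \<open>a\<close>, \<open>b\<close> and whether the bottom box was removable; it
  reads only the neighbouring columns.  Hence operators at distance at least 2 commute, which gives
  (i), (ii) and (iii) for \<open>j > i + 1\<close>.  For \<open>j = i + 1\<close>, write \<open>(x, y)\<close> for the lengths of the two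
  columns.  The kernel of the commutator vanishes unless the new length \<open>y'\<close> of column \<open>j\<close> is at least
  \<open>x\<close>.  Both sides of (iii) are then sums over the same intermediate value \<open>t\<close>, which is the length of
  column \<open>j\<close> on the left and of column \<open>i\<close> on the right, and they agree term by term.
\<close>

section \<open>Weights of column moves and the two-column identity\<close>

text \<open>The weight of the passage from length \<open>x\<close> to length \<open>y\<close> of a column whose bottom box is
  removable iff \<open>t < x\<close>.\<close>

definition weight :: "nat \<Rightarrow> nat \<Rightarrow> nat \<Rightarrow> coeff_ring" where
  "weight t x y =
    (if x < y then \<alpha> ^ (y - x - 1) * (1 + (if t < x then \<alpha> * \<beta> else 0))
     else if x = y \<and> t < x then \<beta> else 0)"

text \<open>The coefficient with which the commutator of two adjacent operators takes column lengths
  \<open>(x, y)\<close> to \<open>(x', y')\<close>; \<open>m\<close> is the length of the left column of \<open>\<mu>\<close>, and the box at the bottom of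
  the right column is removable iff \<open>l < y\<close>.\<close>

definition comm_kernel :: "nat \<Rightarrow> nat \<Rightarrow> nat \<Rightarrow> nat \<Rightarrow> nat \<Rightarrow> nat \<Rightarrow> coeff_ring" where
  "comm_kernel l m x y x' y' = weight l y y' *
    ((if y' \<le> x then weight (max y' m) x x' else 0)
     - (if y' \<le> x' then weight (max y m) x x' else 0))"

lemma weight_eq_0: "y < x \<Longrightarrow> weight t x y = 0"
  by (simp add: weight_def)

text \<open>For \<open>y' < x\<close> both order tests succeed. If \<open>y \<le> y'\<close>,
  exchanging \<open>y\<close> and \<open>y'\<close> in the threshold does not affect whether it is
  below \<open>x\<close>, so the two terms cancel; otherwise \<open>weight l y y'\<close>
  vanishes.\<close>

lemma comm_kernel_eq_0:
  assumes "y' < x" "y \<le> x" "y' \<le> x'"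
  shows "comm_kernel l m x y x' y' = 0"
proof (cases "y \<le> y'")
  case True
  have "max y' m < x \<longleftrightarrow> max y m < x" using True assms by auto
  then have "weight (max y' m) x x' = weight (max y m) x x'" by (simp add: weight_def)
  then show ?thesis using assms by (simp add: comm_kernel_def)
qed (simp add: comm_kernel_def weight_eq_0)

text \<open>Both sides vanish unless \<open>x \<le> t\<close> and \<open>t \<le> y'\<close>: on each
  side either a \<open>weight\<close> would shorten its column or \<open>comm_kernel_eq_0\<close>
  applies. In the remaining range all lengths are linearly ordered and a polynomial identity is
  left.\<close>

lemma comm_kernel_weight:
  assumes "l \<le> y" "y \<le> x" "m \<le> x" "y' \<le> x'"
  shows "comm_kernel l m x y x' t * weight l t y' = weight (max y m) x t * comm_kernel l m t y x' y'"
proof -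
  consider "t < x" | "y' < t" "x \<le> t" | "x \<le> t" "t \<le> y'" by linarith
  then show ?thesis
  proof cases
    case 1
    then show ?thesis
    proof (cases "t \<le> x'")
      case True
      then show ?thesis using 1 assms by (simp add: comm_kernel_eq_0 weight_eq_0)
    next
      case False
      then show ?thesis using 1 assms by (simp add: weight_eq_0)
    qed
  next
    case 2
    then show ?thesis using assms by (simp add: comm_kernel_eq_0 weight_eq_0)
  next
    case 3
    obtain p where p: "x = y + p" using assms(2) le_Suc_ex by blast
    obtain n where n: "t = x + n" using 3(1) le_Suc_ex by blast
    obtain r where r: "y' = t + r" using 3(2) le_Suc_ex by blast
    obtain s where s: "x' = y' + s" using assms(4) le_Suc_ex by blast
    \<comment> \<open>The offsets remove truncated subtraction; whether each is zero settles the
      comparisons between consecutive lengths.\<close>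
    show ?thesis
      using assms(1,3) unfolding s r n p
      by (cases p; cases n; cases r; cases s;
          simp add: comm_kernel_def weight_def power_add algebra_simps max_def)
  qed
qed

section \<open>Partitions as sequences of column lengths\<close>

lemma diagram_iff: "(r, i) \<in> diagram p \<longleftrightarrow> r < col_len p i"
  using column_eq[of i p] by blast

lemma col_len_eqI: "(\<And>r. (r, i) \<in> diagram p \<longleftrightarrow> r < n) \<Longrightarrow> col_len p i = n"
  by (simp add: col_len_def flip: lessThan_def)

lemma inj_col_len: "inj col_len"
proof (rule injI)
  fix p q assume "col_len p = col_len q"
  then have "diagram p = diagram q" by (auto simp: diagram_iff)
  then show "p = q" by (simp add: diagram_inject)
qed

text \<open>Columns are numbered from 1, so index 0 is an empty dummy column and the order condition
  starts at 1.\<close>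

lemma range_col_len_iff:
  "c \<in> range col_len \<longleftrightarrow> c 0 = 0 \<and> (\<forall>i\<ge>1. c (Suc i) \<le> c i) \<and> finite {i. c i \<noteq> 0}"
proof (intro iffI conjI allI impI)
  assume "c \<in> range col_len"
  then obtain p where c: "c = col_len p" by blast
  show "c 0 = 0" unfolding c by (rule col_len_eqI) (simp add: diagram_def)
  show "c (Suc i) \<le> c i" if "1 \<le> i" for i
  proof -
    have "{..<c (Suc i)} \<subseteq> {..<c i}"
      using that unfolding c column_eq[symmetric] by (auto simp: diagram_def)
    then show ?thesis by simp
  qed
  have "{i. c i \<noteq> 0} \<subseteq> snd ` diagram p"
    unfolding c using diagram_iff[of 0 _ p] by force
  then show "finite {i. c i \<noteq> 0}" using finite_diagram finite_subset by blast
next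
  assume asm: "c 0 = 0 \<and> (\<forall>i\<ge>1. c (Suc i) \<le> c i) \<and> finite {i. c i \<noteq> 0}"
  then have c0: "c 0 = 0" and step: "\<And>i. 1 \<le> i \<Longrightarrow> c (Suc i) \<le> c i"
    and fin: "finite {i. c i \<noteq> 0}" by auto
  \<comment> \<open>\<open>S r\<close> collects the columns with a box in row \<open>r\<close>; its
    cardinality is the length of that row, so the partition built is the conjugate of
    \<open>c\<close>.\<close>
  define S where "S r = {i. r < c i}" for r
  have finS: "finite (S r)" for r
    by (rule finite_subset[OF _ fin]) (auto simp: S_def)
  have mono: "c j \<le> c i" if "1 \<le> i" "i \<le> j" for i j
    using that(2,1) by (induction j rule: dec_induct) (auto intro: order_trans[OF step])
  have S_eq: "S r = {1..card (S r)}" for r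
  proof (cases "S r = {}")
    case False
    have "S r = {1..Max (S r)}"
    proof (intro equalityI subsetI)
      fix i assume i: "i \<in> S r"
      then have "i \<noteq> 0" using c0 by (cases "i = 0") (auto simp: S_def)
      then show "i \<in> {1..Max (S r)}" using Max_ge[OF finS i] by simp
    next
      fix i assume "i \<in> {1..Max (S r)}"
      then show "i \<in> S r"
        using Max_in[OF finS False] mono[of i "Max (S r)"] by (auto simp: S_def)
    qed
    then show ?thesis by (metis card_atLeastAtMost diff_Suc_1)
  qed simp
  have "antimono (\<lambda>r. card (S r))"
    by (intro antimonoI card_mono finS) (auto simp: S_def)
  moreover have "{r. card (S r) \<noteq> 0} \<subseteq> {..<c 1}"
  proof
    fix r assume "r \<in> {r. card (S r) \<noteq> 0}"
    then have "1 \<in> S r" by (subst S_eq) simp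
    then show "r \<in> {..<c 1}" by (simp add: S_def)
  qed
  then have "finite {r. card (S r) \<noteq> 0}" using finite_subset by blast
  ultimately have row: "row (Abs_partition (\<lambda>r. card (S r))) = (\<lambda>r. card (S r))"
    by (intro Abs_partition_inverse) simp
  have "col_len (Abs_partition (\<lambda>r. card (S r))) i = c i" for i
  proof (rule col_len_eqI)
    fix r
    have "1 \<le> i \<and> i \<le> card (S r) \<longleftrightarrow> i \<in> S r"
      by (subst (2) S_eq) auto
    also have "i \<in> S r \<longleftrightarrow> r < c i" by (simp add: S_def)
    finally show "(r, i) \<in> diagram (Abs_partition (\<lambda>r. card (S r))) \<longleftrightarrow> r < c i"
      by (simp add: diagram_def row)
  qed
  then show "c \<in> range col_len" by (metis ext rangeI)
qed

lemma contains_iff: "contains p q \<longleftrightarrow> (\<forall>i. col_len q i \<le> col_len p i)"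
proof -
  have "contains p q \<longleftrightarrow> (\<forall>i. {..<col_len q i} \<subseteq> {..<col_len p i})"
    unfolding contains_def subset_iff lessThan_iff split_paired_All diagram_iff by blast
  then show ?thesis by simp
qed

lemma add_boxes_iff: "add_boxes p a i q \<longleftrightarrow> col_len q = (col_len p)(i := col_len p i + a)"
proof
  assume add: "add_boxes p a i q"
  show "col_len q = (col_len p)(i := col_len p i + a)"
  proof
    fix j
    show "col_len q j = ((col_len p)(i := col_len p i + a)) j"
    proof (cases "j = i")
      case False
      then have "col_len q j = col_len p j"
        using add by (intro col_len_eqI) (auto simp: add_boxes_def diagram_iff)
      then show ?thesis using False by simp
    qed (simp add: add_boxes_col_len[OF add])
  qed
qed (auto simp: add_boxes_def diagram_iff split: if_splits)

lemma remove_box_iff: "remove_box p i q \<longleftrightarrow> col_len p = (col_len q)(i := Suc (col_len q i))"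
proof
  assume "remove_box p i q"
  then show "col_len p = (col_len q)(i := Suc (col_len q i))"
    using remove_box_imp_add_boxes add_boxes_iff by simp
next
  assume *: "col_len p = (col_len q)(i := Suc (col_len q i))"
  then have "diagram q = diagram p - {(col_len p i - 1, i)}"
    by (auto simp: diagram_iff split: if_splits)
  then show "remove_box p i q" using * by (simp add: remove_box_def)
qed

section \<open>Coefficients of \<open>u\<close> and \<open>d\<close> in column lengths\<close>

text \<open>Extension by zero allows sums over all updates \<open>c(i := x)\<close> without asking
  which of them are partitions.\<close>

definition column_coeff :: "formal \<Rightarrow> (nat \<Rightarrow> nat) \<Rightarrow> coeff_ring" where
  "column_coeff f c = (if c \<in> range col_len then f (inv col_len c) else 0)"

lemma column_coeff_col_len [simp]: "column_coeff f (col_len p) = f p"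
  by (simp add: column_coeff_def inj_col_len)

lemma column_coeff_eq_0: "c \<notin> range col_len \<Longrightarrow> column_coeff f c = 0"
  by (simp add: column_coeff_def)

lemma column_coeff_diff: "column_coeff (f - g) c = column_coeff f c - column_coeff g c"
  by (simp add: column_coeff_def)

lemma \<alpha>_neq_0: "\<alpha> \<noteq> 0"
  by (simp add: \<alpha>_def)

lemma u_eq:
  "u i f q = (\<Sum>x<col_len q i.
    column_coeff f ((col_len q)(i := x)) * \<alpha> ^ (col_len q i - x - 1))"
proof -
  let ?n = "col_len q i"
  let ?c = "\<lambda>x. (col_len q)(i := x)"
  have u_iff: "u_basis i p q \<noteq> 0 \<longleftrightarrow> col_len p i < ?n \<and> col_len p = ?c (col_len p i)"
    and u_val: "u_basis i p q \<noteq> 0 \<Longrightarrow> u_basis i p q = \<alpha> ^ (?n - col_len p i - 1)" for p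
  proof -
    have *: "col_len p i < ?n \<and> col_len p = ?c (col_len p i)
       \<and> u_basis i p q = \<alpha> ^ (?n - col_len p i - 1)"
      if "u_basis i p q \<noteq> 0"
    proof -
      from u_basis_nonzeroD[OF that] obtain a where a: "1 \<le> a" "add_boxes p a i q" by blast
      then show ?thesis using u_basis_eq[OF a] by (simp add: add_boxes_iff)
    qed
    moreover have "u_basis i p q \<noteq> 0" if "col_len p i < ?n" "col_len p = ?c (col_len p i)"
    proof -
      have "(col_len p)(i := col_len p i + (?n - col_len p i)) = (col_len p)(i := ?n)"
        using that(1) by simp
      also have "\<dots> = col_len q" by (subst that(2)) simp
      finally have "add_boxes p (?n - col_len p i) i q" by (simp add: add_boxes_iff)
      then show ?thesis using that(1) u_basis_eq[of "?n - col_len p i" p i q] \<alpha>_neq_0 by simp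
    qed
    ultimately show "u_basis i p q \<noteq> 0 \<longleftrightarrow> col_len p i < ?n \<and> col_len p = ?c (col_len p i)"
      and "u_basis i p q \<noteq> 0 \<Longrightarrow> u_basis i p q = \<alpha> ^ (?n - col_len p i - 1)" by blast+
  qed
  \<comment> \<open>A source \<open>p\<close> is determined by its length in column
    \<open>i\<close>. The sum runs at first only over lengths that give a partition;
    \<open>column_coeff\<close> is zero at the others.\<close>
  have "u i f q = (\<Sum>x\<in>{x\<in>{..<?n}. ?c x \<in> range col_len}.
      column_coeff f (?c x) * \<alpha> ^ (?n - x - 1))"
    unfolding u_def lin_ext_def
  proof (rule sum.reindex_bij_witness[where i = "\<lambda>x. inv col_len (?c x)" and j = "\<lambda>p. col_len p i"])
    fix p assume "p \<in> {p. u_basis i p q \<noteq> 0}"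
    then have nz: "u_basis i p q \<noteq> 0" and p: "col_len p i < ?n" "?c (col_len p i) = col_len p"
      using u_iff[of p] by auto
    show "inv col_len (?c (col_len p i)) = p" by (simp add: p inj_col_len)
    show "col_len p i \<in> {x \<in> {..<?n}. ?c x \<in> range col_len}" by (simp add: p)
    show "column_coeff f (?c (col_len p i)) * \<alpha> ^ (?n - col_len p i - 1) = f p * u_basis i p q"
      by (simp add: p(2) u_val[OF nz])
  next
    fix x assume "x \<in> {x \<in> {..<?n}. ?c x \<in> range col_len}"
    then have x: "x < ?n" "col_len (inv col_len (?c x)) = ?c x" by (auto simp: f_inv_into_f)
    show "col_len (inv col_len (?c x)) i = x" by (simp add: x)
    show "inv col_len (?c x) \<in> {p. u_basis i p q \<noteq> 0}" by (simp add: u_iff x)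
  qed
  also have "\<dots> = (\<Sum>x<?n. column_coeff f (?c x) * \<alpha> ^ (?n - x - 1))"
    by (rule sum.mono_neutral_left) (auto simp: column_coeff_eq_0)
  finally show ?thesis .
qed

lemma d_eq:
  "d \<mu> i f q =
    (if contains q \<mu> then column_coeff f ((col_len q)(i := Suc (col_len q i))) * \<beta> else 0)"
proof -
  let ?c = "(col_len q)(i := Suc (col_len q i))"
  have \<beta>: "\<beta> \<noteq> 0" by (simp add: \<beta>_def)
  show ?thesis
  proof (cases "contains q \<mu> \<and> ?c \<in> range col_len")
    case True
    then obtain p where p: "col_len p = ?c" by auto
    have "{p. d_basis \<mu> i p q \<noteq> 0} = {p}"
      using True \<beta> by (auto simp: d_basis_def remove_box_iff p[symmetric] dest: injD[OF inj_col_len])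
    moreover have "d_basis \<mu> i p q = \<beta>" using True by (simp add: d_basis_def remove_box_iff p)
    ultimately show ?thesis using True by (simp add: d_def lin_ext_def flip: p)
  next
    case False
    then have "{p. d_basis \<mu> i p q \<noteq> 0} = {}"
      by (auto simp: d_basis_def remove_box_iff) (metis rangeI)
    then show ?thesis using False by (auto simp: d_def lin_ext_def column_coeff_eq_0)
  qed
qed

section \<open>The operator \<open>u_tilde\<close> in column lengths\<close>

text \<open>\<open>u_tilde\<close> on arbitrary functions of the column lengths, read off at the target \<open>c\<close>: the test
  says that \<open>c\<close> is weakly decreasing at \<open>i\<close>, the first column being unbounded.\<close>

definition column_op ::
  "partition \<Rightarrow> nat \<Rightarrow> ((nat \<Rightarrow> nat) \<Rightarrow> coeff_ring) \<Rightarrow> (nat \<Rightarrow> nat) \<Rightarrow> coeff_ring" where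
  "column_op \<mu> i G c =
    (if i = 1 \<or> c i \<le> c (i - 1)
     then \<Sum>x\<le>c i. G (c(i := x)) * weight (max (c (Suc i)) (col_len \<mu> i)) x (c i) else 0)"

text \<open>This is \<open>u\<close> after \<open>id + d\<close> within one column:
  \<open>h x\<close> contributes \<open>\<alpha> ^ (n - x - 1)\<close> directly if
  \<open>x < n\<close>, and \<open>\<beta> * \<alpha> ^ (n - x)\<close> through a removed box if
  \<open>t < x\<close>. For \<open>x < n\<close> the two combine to the factor
  \<open>1 + \<alpha> * \<beta>\<close>; for \<open>x = n\<close> only \<open>\<beta>\<close>
  remains.\<close>

lemma sum_weight:
  "(\<Sum>x<n. (h x + (if t \<le> x then h (Suc x) * \<beta> else 0)) * \<alpha> ^ (n - x - 1))
    = (\<Sum>x\<le>n. h x * weight t x n)"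
proof -
  let ?k = "\<lambda>x. if t < x then h x * \<beta> * \<alpha> ^ (n - x) else 0"
  have "(\<Sum>x<n. (h x + (if t \<le> x then h (Suc x) * \<beta> else 0)) * \<alpha> ^ (n - x - 1))
      = (\<Sum>x<n. h x * \<alpha> ^ (n - x - 1)) + (\<Sum>x<n. ?k (Suc x))"
    unfolding sum.distrib[symmetric] by (intro sum.cong) (auto simp: algebra_simps)
  \<comment> \<open>The extra term at \<open>x = 0\<close> is zero since \<open>t < 0\<close> is
    false.\<close>
  also have "(\<Sum>x<n. ?k (Suc x)) = (\<Sum>x\<le>n. ?k x)"
    by (simp add: sum.atMost_shift)
  also have "(\<Sum>x<n. h x * \<alpha> ^ (n - x - 1)) = (\<Sum>x\<le>n. if x < n then h x * \<alpha> ^ (n - x - 1) else 0)"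
    by (rule sum.mono_neutral_cong_left) auto
  also have "\<dots> + (\<Sum>x\<le>n. ?k x) = (\<Sum>x\<le>n. h x * weight t x n)"
    unfolding sum.distrib[symmetric]
  proof (intro sum.cong)
    fix x assume "x \<in> {..n}"
    then consider "x = n" | m where "n = Suc (x + m)" using less_natE[of x n] by force
    then show "(if x < n then h x * \<alpha> ^ (n - x - 1) else 0) + ?k x = h x * weight t x n"
      by cases (auto simp: weight_def algebra_simps)
  qed simp
  finally show ?thesis .
qed

text \<open>The threshold in \<open>weight\<close> merges both conditions for removing a box: the
  length left must be at least that of the next column and that of the same column of
  \<open>\<mu>\<close>.\<close>

lemma column_coeff_u_tilde:
  assumes f: "f \<in> M \<mu>" and i: "1 \<le> i"
  shows "column_coeff (u_tilde \<mu> i f) = column_op \<mu> i (column_coeff f)"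
proof
  fix c
  show "column_coeff (u_tilde \<mu> i f) c = column_op \<mu> i (column_coeff f) c"
  proof (cases "c \<in> range col_len")
    case True
    then obtain q where q: "c = col_len q" by blast
    have c: "c 0 = 0" "\<And>i. 1 \<le> i \<Longrightarrow> c (Suc i) \<le> c i" "finite {i. c i \<noteq> 0}"
      using True range_col_len_iff by auto
    have "c i \<le> c (i - 1)" if "i \<noteq> 1" using c(2)[of "i - 1"] i that by simp
    then have bound: "i = 1 \<or> c i \<le> c (i - 1)" by blast
    let ?t = "max (c (Suc i)) (col_len \<mu> i)"
    let ?h = "\<lambda>x. column_coeff f (c(i := x))"
    have g: "column_coeff (f + d \<mu> i f) (c(i := x)) =
        ?h x + (if ?t \<le> x then ?h (Suc x) * \<beta> else 0)" if "x < c i" for x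
    proof (cases "c(i := x) \<in> range col_len")
      case True
      then obtain p where p: "c(i := x) = col_len p" by blast
      have px: "col_len p i = x" "col_len p (Suc i) = c (Suc i)"
        unfolding p[symmetric] by simp_all
      have "c (Suc i) \<le> x"
        using True i px p range_col_len_iff[of "c(i := x)"] by (metis)
      \<comment> \<open>The source of the removal contains \<open>\<mu>\<close> because
        \<open>f\<close> lies in \<open>M \<mu>\<close>, so only column \<open>i\<close> of the
        result has to be compared.\<close>
      moreover have "contains p \<mu> \<longleftrightarrow> col_len \<mu> i \<le> x" if "?h (Suc x) \<noteq> 0"
      proof -
        from that obtain p' where p': "c(i := Suc x) = col_len p'"
          using column_coeff_eq_0 by blast
        then have "f p' \<noteq> 0" using that by simp
        then have "contains p' \<mu>" using f by (simp add: M_def)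
        then have *: "col_len \<mu> j \<le> (c(i := Suc x)) j" for j
          unfolding contains_iff p' by blast
        show ?thesis
        proof
          assume "contains p \<mu>"
          then show "col_len \<mu> i \<le> x" using px contains_iff by metis
        next
          assume le: "col_len \<mu> i \<le> x"
          have "col_len \<mu> j \<le> (c(i := x)) j" for j using *[of j] le by (cases "j = i") auto
          then show "contains p \<mu>" unfolding p contains_iff by blast
        qed
      qed
      moreover have "(col_len p)(i := Suc (col_len p i)) = c(i := Suc x)"
        unfolding p[symmetric] by simp
      ultimately show ?thesis unfolding p by (auto simp: d_eq)
    next
      case False
      \<comment> \<open>Lowering entry \<open>i\<close> of a partition can only break the order
        relative to the next column; then the threshold test fails and both sides are zero.\<close>
      have "\<not> c (Suc i) \<le> x"
      proof
        assume le: "c (Suc i) \<le> x"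
        have "finite {j. (c(i := x)) j \<noteq> 0}"
          by (rule finite_subset[of _ "insert i {j. c j \<noteq> 0}"]) (use c(3) in auto)
        moreover have "(c(i := x)) (Suc j) \<le> (c(i := x)) j" if "1 \<le> j" for j
          using c(2)[OF that] le \<open>x < c i\<close> by auto
        ultimately have "c(i := x) \<in> range col_len"
          using c(1) i unfolding range_col_len_iff by simp
        then show False using False by blast
      qed
      then show ?thesis using False by (simp add: column_coeff_eq_0)
    qed
    have "column_coeff (u_tilde \<mu> i f) c = u i (f + d \<mu> i f) q"
      by (simp add: q u_tilde_def)
    also have "\<dots> = (\<Sum>x<c i. column_coeff (f + d \<mu> i f) (c(i := x)) * \<alpha> ^ (c i - x - 1))"
      unfolding u_eq q ..
    also have "\<dots> = (\<Sum>x<c i. (?h x + (if ?t \<le> x then ?h (Suc x) * \<beta> else 0)) * \<alpha> ^ (c i - x - 1))"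
      by (intro sum.cong refl) (simp only: g lessThan_iff)
    also have "\<dots> = column_op \<mu> i (column_coeff f) c"
      unfolding sum_weight[of ?h] column_op_def using bound by simp
    finally show ?thesis .
  next
    case False
    \<comment> \<open>If \<open>c(i := x)\<close> were a partition, raising entry \<open>i\<close>
      to \<open>c i\<close> would keep it one, as \<open>bound\<close> controls the left
      neighbour.\<close>
    have "column_coeff f (c(i := x)) = 0" if bound: "i = 1 \<or> c i \<le> c (i - 1)" and x: "x \<le> c i" for x
    proof (rule column_coeff_eq_0, rule notI)
      assume "c(i := x) \<in> range col_len"
      then have cx: "(c(i := x)) 0 = 0" "\<And>j. 1 \<le> j \<Longrightarrow> (c(i := x)) (Suc j) \<le> (c(i := x)) j"
        "finite {j. (c(i := x)) j \<noteq> 0}" using range_col_len_iff by auto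
      have "finite {j. c j \<noteq> 0}"
        by (rule finite_subset[of _ "insert i {j. (c(i := x)) j \<noteq> 0}"]) (use cx(3) in auto)
      moreover have "c (Suc j) \<le> c j" if "1 \<le> j" for j
        using cx(2)[OF that] bound x that by (auto split: if_splits)
      moreover have "c 0 = 0" using cx(1) i by simp
      ultimately have "c \<in> range col_len" unfolding range_col_len_iff by blast
      then show False using False by blast
    qed
    then show ?thesis using False by (simp add: column_coeff_eq_0 column_op_def)
  qed
qed

section \<open>Commutation and commutators of column operators\<close>

lemma upd_Suc_twist: "c(Suc n := y, n := x) = c(n := x, Suc n := y)"
  by (rule fun_upd_twist) simp

text \<open>The bound and the weight of each operator read only entries that the other leaves alone,
  so both orders give the same double sum.\<close>

lemma column_op_far_commute:
  assumes "1 \<le> i" "Suc i < k"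
  shows "column_op \<mu> i (column_op \<mu> k G) = column_op \<mu> k (column_op \<mu> i G)"
proof
  fix c :: "nat \<Rightarrow> nat"
  let ?B = "\<lambda>i. i = 1 \<or> c i \<le> c (i - 1)"
  let ?w = "\<lambda>i x. weight (max (c (Suc i)) (col_len \<mu> i)) x (c i)"
  have ne: "k \<noteq> i" "k - Suc 0 \<noteq> i" "Suc k \<noteq> i" "i - Suc 0 \<noteq> k" "Suc i \<noteq> k"
    using assms by auto
  have "column_op \<mu> i (column_op \<mu> k G) c = (if ?B i \<and> ?B k then
      \<Sum>x\<le>c i. \<Sum>y\<le>c k. G (c(i := x, k := y)) * ?w k y * ?w i x else 0)"
    using assms ne
    by (auto simp: column_op_def sum_distrib_right intro!: sum.cong sum.neutral)
  also have "\<dots> = (if ?B i \<and> ?B k then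
      \<Sum>y\<le>c k. \<Sum>x\<le>c i. G (c(k := y, i := x)) * ?w i x * ?w k y else 0)"
    using assms by (subst sum.swap) (simp add: fun_upd_twist mult_ac)
  also have "\<dots> = column_op \<mu> k (column_op \<mu> i G) c"
    using assms ne
    by (auto simp: column_op_def sum_distrib_right intro!: sum.cong sum.neutral)
  finally show "column_op \<mu> i (column_op \<mu> k G) c = column_op \<mu> k (column_op \<mu> i G) c" .
qed

definition column_comm ::
  "partition \<Rightarrow> nat \<Rightarrow> ((nat \<Rightarrow> nat) \<Rightarrow> coeff_ring) \<Rightarrow> (nat \<Rightarrow> nat) \<Rightarrow> coeff_ring" where
  "column_comm \<mu> i G c =
    column_op \<mu> i (column_op \<mu> (Suc i) G) c - column_op \<mu> (Suc i) (column_op \<mu> i G) c"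

text \<open>Operators are read off at the target, so the outer one acts on \<open>c\<close> first.
  With \<open>i\<close> outer, the order test of the right column sees the old length
  \<open>x\<close> of the left one; with \<open>Suc i\<close> outer, it sees \<open>c i\<close>, and
  the left threshold uses the old length \<open>y\<close>. These are the two terms of
  \<open>comm_kernel\<close>.\<close>

lemma column_comm_eq:
  assumes "1 \<le> i"
  shows "column_comm \<mu> i G c =
    (if i = 1 \<or> c i \<le> c (i - 1) then \<Sum>x\<le>c i. \<Sum>y\<le>c (Suc i). G (c(i := x, Suc i := y)) *
       comm_kernel (max (c (Suc (Suc i))) (col_len \<mu> (Suc i))) (col_len \<mu> i) x y (c i) (c (Suc i))
     else 0)"
proof (cases "i = 1 \<or> c i \<le> c (i - 1)")
  case True
  let ?j = "Suc i"
  let ?l = "max (c (Suc ?j)) (col_len \<mu> ?j)"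
  let ?m = "col_len \<mu> i"
  let ?G = "\<lambda>x y. G (c(i := x, ?j := y))"
  have "column_op \<mu> i (column_op \<mu> ?j G) c = (\<Sum>x\<le>c i. \<Sum>y\<le>c ?j. ?G x y *
      (weight ?l y (c ?j) * (if c ?j \<le> x then weight (max (c ?j) ?m) x (c i) else 0)))"
    using True assms
    by (auto simp: column_op_def sum_distrib_left sum_distrib_right mult_ac intro!: sum.cong)
  moreover have "column_op \<mu> ?j (column_op \<mu> i G) c = (\<Sum>y\<le>c ?j. \<Sum>x\<le>c i. ?G x y *
      (weight ?l y (c ?j) * (if c ?j \<le> c i then weight (max y ?m) x (c i) else 0)))"
    using True assms
    by (auto simp: column_op_def sum_distrib_left sum_distrib_right mult_ac upd_Suc_twist
        intro!: sum.cong)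
  ultimately show ?thesis
    using True
    by (simp add: column_comm_def comm_kernel_def right_diff_distrib sum_subtractf
        sum.swap[of _ "{..c ?j}"])
qed (use assms in \<open>auto simp: column_comm_def column_op_def intro!: sum.neutral\<close>)

text \<open>The hypothesis on \<open>G\<close> holds for coefficients of elements of
  \<open>M \<mu>\<close> and supplies the inequalities for \<open>comm_kernel_weight\<close>. Sums
  are padded with zero terms to ranges independent of \<open>t\<close> so that they can be
  interchanged.\<close>

lemma column_comm_commute:
  assumes i: "1 \<le> i"
    and G: "\<And>c. G c \<noteq> 0 \<Longrightarrow> c (Suc (Suc i)) \<le> c (Suc i) \<and> c (Suc i) \<le> c i
      \<and> col_len \<mu> (Suc i) \<le> c (Suc i) \<and> col_len \<mu> i \<le> c i"
  shows "column_op \<mu> (Suc i) (column_comm \<mu> i G) c = column_comm \<mu> i (column_op \<mu> i G) c"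
proof (cases "i = 1 \<or> c i \<le> c (i - 1)")
  case True
  let ?j = "Suc i"
  let ?x = "c i" and ?y = "c ?j"
  let ?l = "max (c (Suc ?j)) (col_len \<mu> ?j)"
  let ?m = "col_len \<mu> i"
  let ?G = "\<lambda>x y. G (c(i := x, ?j := y))"
  let ?C = "comm_kernel ?l ?m"
  have ne: "i - Suc 0 \<noteq> Suc i" using i by simp
  have inner: "column_comm \<mu> i G (c(?j := t)) = (\<Sum>x\<le>?x. \<Sum>y\<le>t. ?G x y * ?C x y ?x t)" for t
    using True i ne by (auto simp: column_comm_eq upd_Suc_twist)
  have inner': "column_op \<mu> i G (c(i := t, ?j := y)) = (\<Sum>x\<le>t. ?G x y * weight (max y ?m) x t)"
    if "t \<le> ?x" for t y
    using True i ne that by (auto simp: column_op_def upd_Suc_twist)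
  have "column_op \<mu> ?j (column_comm \<mu> i G) c = (if ?y \<le> ?x then
      \<Sum>t\<le>?y. \<Sum>x\<le>?x. \<Sum>y\<le>t. ?G x y * (?C x y ?x t * weight ?l t ?y) else 0)"
    using i by (simp add: column_op_def inner sum_distrib_right mult.assoc)
  \<comment> \<open>Terms with \<open>y > t\<close> are zero because the kernel contains
    \<open>weight ?l y t\<close>.\<close>
  also have "\<dots> = (if ?y \<le> ?x then
      \<Sum>t\<le>?y. \<Sum>x\<le>?x. \<Sum>y\<le>?y. ?G x y * (?C x y ?x t * weight ?l t ?y) else 0)"
    by (rule if_cong[OF refl _ refl], (rule sum.cong[OF refl])+, rule sum.mono_neutral_left)
      (auto simp: comm_kernel_def weight_eq_0)
  also have "\<dots> = (if ?y \<le> ?x then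
      \<Sum>x\<le>?x. \<Sum>y\<le>?y. \<Sum>t\<le>?y. ?G x y * (?C x y ?x t * weight ?l t ?y) else 0)"
    by (rule if_cong[OF refl _ refl], rule trans[OF sum.swap], rule sum.cong[OF refl sum.swap])
  also have "\<dots> = (\<Sum>x\<le>?x. \<Sum>y\<le>?y. \<Sum>t\<le>?x. ?G x y * (weight (max y ?m) x t * ?C t y ?x ?y))"
  proof (cases "?y \<le> ?x")
    case True
    have "(\<Sum>t\<le>?y. ?G x y * (?C x y ?x t * weight ?l t ?y)) =
        (\<Sum>t\<le>?x. ?G x y * (weight (max y ?m) x t * ?C t y ?x ?y))" for x y
    proof (cases "?G x y = 0")
      case False
      from G[OF this] have xy: "?l \<le> y" "y \<le> x" "?m \<le> x" by auto
      \<comment> \<open>Lengths \<open>t > ?y\<close> add nothing, as \<open>weight ?l t ?y\<close>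
        is then zero.\<close>
      have "(\<Sum>t\<le>?y. ?G x y * (?C x y ?x t * weight ?l t ?y)) =
          (\<Sum>t\<le>?x. ?G x y * (?C x y ?x t * weight ?l t ?y))"
        using True by (intro sum.mono_neutral_left) (auto simp: weight_eq_0)
      then show ?thesis by (simp only: comm_kernel_weight[OF xy True])
    qed simp
    then show ?thesis using True by simp
  next
    case False
    \<comment> \<open>Here \<open>t \<le> ?x\<close> and \<open>?x < ?y\<close>, so both tests
      inside \<open>comm_kernel\<close> fail.\<close>
    then show ?thesis by (simp add: comm_kernel_def)
  qed
  also have "\<dots> = (\<Sum>t\<le>?x. \<Sum>y\<le>?y. \<Sum>x\<le>?x. ?G x y * (weight (max y ?m) x t * ?C t y ?x ?y))"
    by (rule trans[OF sum.swap]) (rule trans[OF sum.cong[OF refl sum.swap] sum.swap])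
  \<comment> \<open>This returns to the range in \<open>inner'\<close>: for \<open>x > t\<close> the
    weight is zero.\<close>
  also have "\<dots> = (\<Sum>t\<le>?x. \<Sum>y\<le>?y. \<Sum>x\<le>t. ?G x y * (weight (max y ?m) x t * ?C t y ?x ?y))"
    by ((rule sum.cong[OF refl])+, rule sum.mono_neutral_right) (auto simp: weight_eq_0)
  also have "\<dots> = column_comm \<mu> i (column_op \<mu> i G) c"
    using True by (simp add: column_comm_eq[OF i] inner' sum_distrib_right mult.assoc)
  finally show ?thesis .
qed (use i in \<open>auto simp: column_comm_eq column_op_def intro!: sum.neutral\<close>)

section \<open>Relations between the operators on \<open>M \<mu>\<close>\<close>

text \<open>A formal combination is determined by its \<open>column_coeff\<close>, so identities of
  \<open>column_op\<close> carry over.\<close>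

lemma u_tilde_far_commute:
  assumes f: "f \<in> M \<mu>" and "1 \<le> i" "Suc i < k"
  shows "u_tilde \<mu> i (u_tilde \<mu> k f) = u_tilde \<mu> k (u_tilde \<mu> i f)"
proof
  fix q
  have "column_coeff (u_tilde \<mu> i (u_tilde \<mu> k f)) = column_coeff (u_tilde \<mu> k (u_tilde \<mu> i f))"
    using assms by (simp add: column_coeff_u_tilde u_tilde_in_M column_op_far_commute[OF assms(2,3)])
  then show "u_tilde \<mu> i (u_tilde \<mu> k f) q = u_tilde \<mu> k (u_tilde \<mu> i f) q"
    by (metis column_coeff_col_len)
qed

lemma commutator_in_M: "f \<in> M \<mu> \<Longrightarrow> commutator (u_tilde \<mu> i) (u_tilde \<mu> j) f \<in> M \<mu>"
proof -
  assume f: "f \<in> M \<mu>"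
  have "u_tilde \<mu> i (u_tilde \<mu> j f) \<in> M \<mu>" "u_tilde \<mu> j (u_tilde \<mu> i f) \<in> M \<mu>"
    using f by (simp_all add: u_tilde_in_M)
  then show "commutator (u_tilde \<mu> i) (u_tilde \<mu> j) f \<in> M \<mu>"
    unfolding commutator_def M_def by simp metis
qed

lemma column_coeff_commutator:
  assumes "f \<in> M \<mu>" "1 \<le> i"
  shows "column_coeff (commutator (u_tilde \<mu> i) (u_tilde \<mu> (Suc i)) f) = column_comm \<mu> i (column_coeff f)"
  using assms
  by (simp add: fun_eq_iff commutator_def column_coeff_diff column_coeff_u_tilde u_tilde_in_M column_comm_def)

lemma u_tilde_commutator:
  assumes f: "f \<in> M \<mu>" and i: "1 \<le> i"
  shows "u_tilde \<mu> (Suc i) (commutator (u_tilde \<mu> i) (u_tilde \<mu> (Suc i)) f) =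
    commutator (u_tilde \<mu> i) (u_tilde \<mu> (Suc i)) (u_tilde \<mu> i f)"
    (is "?lhs = ?rhs")
proof
  fix q
  have supp: "c (Suc (Suc i)) \<le> c (Suc i) \<and> c (Suc i) \<le> c i
      \<and> col_len \<mu> (Suc i) \<le> c (Suc i) \<and> col_len \<mu> i \<le> c i" if "column_coeff f c \<noteq> 0"
    for c :: "nat \<Rightarrow> nat"
  proof -
    have c: "c \<in> range col_len" using that column_coeff_eq_0 by blast
    then obtain p where p: "c = col_len p" by blast
    have "contains p \<mu>" using that f by (simp add: p M_def)
    then show ?thesis using c i by (simp add: p contains_iff range_col_len_iff)
  qed
  have "column_coeff ?lhs = column_op \<mu> (Suc i) (column_comm \<mu> i (column_coeff f))"
    using f i by (simp add: column_coeff_u_tilde commutator_in_M column_coeff_commutator)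
  also have "\<dots> = column_comm \<mu> i (column_op \<mu> i (column_coeff f))"
    using column_comm_commute[OF i supp] by (rule ext)
  also have "\<dots> = column_coeff ?rhs"
    using f i by (simp add: column_coeff_u_tilde u_tilde_in_M column_coeff_commutator)
  finally show "?lhs q = ?rhs q" by (metis column_coeff_col_len)
qed

lemma u_tilde_zero: "u_tilde \<mu> i 0 = 0"
  by (simp add: u_tilde_def u_def d_def lin_ext_def fun_eq_iff)

theorem theorem5p3:
  fixes \<mu> :: partition
  shows "\<forall>f \<in> M \<mu>.
    (\<forall>i j k. 1 \<le> i \<and> i < j \<and> j < k \<longrightarrow>
      (u_tilde \<mu> i \<circ> u_tilde \<mu> k \<circ> u_tilde \<mu> j) f = (u_tilde \<mu> k \<circ> u_tilde \<mu> i \<circ> u_tilde \<mu> j) f) \<and>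
    (\<forall>i j k. 1 \<le> i \<and> i < j \<and> j < k \<longrightarrow>
      (u_tilde \<mu> j \<circ> u_tilde \<mu> k \<circ> u_tilde \<mu> i) f = (u_tilde \<mu> j \<circ> u_tilde \<mu> i \<circ> u_tilde \<mu> k) f) \<and>
    (\<forall>i j. 1 \<le> i \<and> i < j \<longrightarrow>
      (u_tilde \<mu> j \<circ> commutator (u_tilde \<mu> i) (u_tilde \<mu> j)) f =
      (commutator (u_tilde \<mu> i) (u_tilde \<mu> j) \<circ> u_tilde \<mu> i) f)"
proof (intro ballI conjI allI impI)
  fix f and i j k :: nat assume f: "f \<in> M \<mu>" and ijk: "1 \<le> i \<and> i < j \<and> j < k"
  then have "1 \<le> i" "Suc i < k" by auto
  note far = u_tilde_far_commute[OF _ this]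
  show "(u_tilde \<mu> i \<circ> u_tilde \<mu> k \<circ> u_tilde \<mu> j) f = (u_tilde \<mu> k \<circ> u_tilde \<mu> i \<circ> u_tilde \<mu> j) f"
    using far[OF u_tilde_in_M[OF f]] by simp
  show "(u_tilde \<mu> j \<circ> u_tilde \<mu> k \<circ> u_tilde \<mu> i) f = (u_tilde \<mu> j \<circ> u_tilde \<mu> i \<circ> u_tilde \<mu> k) f"
    using far[OF f] by simp
next
  fix f and i j :: nat assume f: "f \<in> M \<mu>" and ij: "1 \<le> i \<and> i < j"
  show "(u_tilde \<mu> j \<circ> commutator (u_tilde \<mu> i) (u_tilde \<mu> j)) f =
      (commutator (u_tilde \<mu> i) (u_tilde \<mu> j) \<circ> u_tilde \<mu> i) f"
  proof (cases "j = Suc i")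
    case True
    then show ?thesis using u_tilde_commutator[OF f] ij by simp
  next
    case False
    then have "1 \<le> i" "Suc i < j" using ij by auto
    then have "commutator (u_tilde \<mu> i) (u_tilde \<mu> j) g = 0" if "g \<in> M \<mu>" for g
      using u_tilde_far_commute[OF that] by (simp add: commutator_def)
    \<comment> \<open>The commutator kills both \<open>f\<close> and
      \<open>u_tilde \<mu> i f\<close>, which again lies in \<open>M \<mu>\<close>.\<close>
    then show ?thesis using f by (simp add: u_tilde_in_M u_tilde_zero)
  qed
qed

end
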